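(* For every fixed $t>-1/8$ and all integers $n\ge2$, \[ \ln\mathbb E\,e^{-t\hat L_n}=\frac{1-\sqrt{1+8t}}{4}\ln n+O(1), \] where the $O(1)$ term is bounded uniformly in $n$ (for fixed $t$).
   Context: $(B_t)_{t\ge0}$ is a standard Brownian motion and $\hat L_n=\int_1^nB_t^2/t^2\,dt$. *)

theory Defs
  imports "HOL-Probability.Probability"
begin

definition brownian_motion :: "'a measure \<Rightarrow> (real \<Rightarrow> 'a \<Rightarrow> real) \<Rightarrow> bool" where
  "brownian_motion M B \<longleftrightarrow>
     prob_space M \<and>
     (\<forall>t\<ge>0. B t \<in> borel_measurable M) \<and>
     (\<forall>\<omega>\<in>space M. B 0 \<omega> = 0) \<and>
     (\<forall>\<omega>\<in>space M. continuous_on {0..} (\<lambda>t. B t \<omega>)) \<and>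
     (\<forall>s t. 0 \<le> s \<longrightarrow> s < t \<longrightarrow>
        distributed M lborel (\<lambda>\<omega>. B t \<omega> - B s \<omega>)
          (\<lambda>x. ennreal (normal_density 0 (sqrt (t - s)) x))) \<and>
     (\<forall>ts :: real list. sorted_wrt (<) ts \<longrightarrow> (\<forall>x\<in>set ts. 0 \<le> x) \<longrightarrow>
        prob_space.indep_vars M (\<lambda>_. borel)
          (\<lambda>i \<omega>. B (ts ! Suc i) \<omega> - B (ts ! i) \<omega>) {..<length ts - 1})"

definition Lhat :: "(real \<Rightarrow> 'a \<Rightarrow> real) \<Rightarrow> nat \<Rightarrow> 'a \<Rightarrow> real" where
  "Lhat B n \<omega> = integral {1..real n} (\<lambda>s. (B s \<omega>)\<^sup>2 / s\<^sup>2)"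

end

theory Submission
  imports Defs "HOL-Real_Asymp.Real_Asymp"
begin

text \<open>
  Let \<open>\<alpha> = (1 - sqrt (1 + 8 t)) / 4\<close>, the smaller root of \<open>2 \<alpha>\<^sup>2 - \<alpha> = t\<close>. Formally,
  \<open>s powr (-\<alpha>) * exp (\<alpha> B\<^sub>s\<^sup>2 / s - t L\<^sub>s)\<close> is a martingale. Instead of stochastic calculus we use its
  exact discrete analogue on the geometric grid \<open>q^i\<close>, where \<open>B(q^i) / sqrt (q^i)\<close> is a stationary
  autoregressive Gaussian chain: with a weight \<open>w\<close> close to \<open>-t\<close> one Gaussian integration per step
  evaluates the exponential moment with terminal factor \<open>exp (\<alpha> B\<^sup>2 / s)\<close> exactly, and it bounds the one with
  terminal factor \<open>exp (B\<^sup>2 / (4 s))\<close> by a constant multiple, because \<open>\<alpha> < 1/4\<close> is the attracting fixed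
  point of the exponent recursion and the repelling one exceeds 1/4. The moment without
  terminal factor is at most the second one; it is bounded below through
  \<open>exp (\<alpha> y) \<le> exp (\<bar>\<alpha>\<bar> K) + exp (- (1/4 - \<alpha>) K) exp (y/4)\<close> for \<open>y \<ge> 0\<close>, with \<open>K\<close> large. As the mesh tends to 0 the Riemann sums converge pathwise;
  the upper bound passes to the limit by Fatou and the lower one by uniform integrability.
\<close>

section \<open>Gaussian integration and the increments of Brownian motion\<close>

text \<open>Completing the square in \<open>z\<close> turns the integrand into the constant
  \<open>c\<close> times the normal density of mean \<open>\<mu>\<close> and variance
  \<open>\<sigma>\<^sup>2 / D\<close>. The condition
  \<open>2 * \<theta> * \<sigma>\<^sup>2 < 1\<close> says \<open>D > 0\<close>; otherwise the
  integral diverges.\<close>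

lemma nn_integral_normal_density_exp_square:
  fixes \<theta> \<sigma> x :: real
  assumes "\<sigma> > 0" "2 * \<theta> * \<sigma>\<^sup>2 < 1"
  shows "(\<integral>\<^sup>+z. ennreal (normal_density 0 \<sigma> z) * ennreal (exp (\<theta> * (x + z)\<^sup>2)) \<partial>lborel)
    = ennreal (exp (\<theta> * x\<^sup>2 / (1 - 2 * \<theta> * \<sigma>\<^sup>2)) / sqrt (1 - 2 * \<theta> * \<sigma>\<^sup>2))"
proof -
  define D where "D = 1 - 2 * \<theta> * \<sigma>\<^sup>2"
  have D: "D > 0" using assms by (simp add: D_def)
  define \<mu> where "\<mu> = 2 * \<theta> * \<sigma>\<^sup>2 * x / D"
  define c where "c = exp (\<theta> * x\<^sup>2 / D) / sqrt D"
  have c: "c \<ge> 0" using D by (simp add: c_def)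
  have eq: "normal_density 0 \<sigma> z * exp (\<theta> * (x + z)\<^sup>2) = c * normal_density \<mu> (\<sigma> / sqrt D) z" for z
  proof -
    have "\<theta> * (x + z)\<^sup>2 - z\<^sup>2 / (2 * \<sigma>\<^sup>2) = \<theta> * x\<^sup>2 / D - (z - \<mu>)\<^sup>2 * D / (2 * \<sigma>\<^sup>2)"
    proof -
      have th: "\<theta> = (1 - D) / (2 * \<sigma>\<^sup>2)" using assms by (simp add: D_def)
      have mu: "\<mu> = (1 - D) * x / D" using assms by (simp add: D_def \<mu>_def)
      have "D * (\<theta> * (x + z)\<^sup>2 - z\<^sup>2 / (2 * \<sigma>\<^sup>2)) = D * (\<theta> * x\<^sup>2 / D - (z - \<mu>)\<^sup>2 * D / (2 * \<sigma>\<^sup>2))"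
        unfolding th mu using assms(1) D
        by (simp add: field_simps power2_eq_square)
      then show ?thesis using D by simp
    qed
    then have ex: "exp (\<theta> * (x + z)\<^sup>2) * exp (- z\<^sup>2 / (2 * \<sigma>\<^sup>2))
        = exp (\<theta> * x\<^sup>2 / D) * exp (- ((z - \<mu>)\<^sup>2 * D / (2 * \<sigma>\<^sup>2)))"
      by (simp add: exp_add[symmetric])
    have s: "(\<sigma> / sqrt D)\<^sup>2 = \<sigma>\<^sup>2 / D" using D by (simp add: power_divide)
    have r: "sqrt (2 * pi * (\<sigma>\<^sup>2 / D)) = sqrt (2 * pi * \<sigma>\<^sup>2) / sqrt D"
      by (simp add: real_sqrt_divide)
    show ?thesis
      unfolding normal_density_def s r c_def
      using D ex by (simp add: field_simps)
  qed
  have "(\<integral>\<^sup>+z. ennreal (normal_density 0 \<sigma> z) * ennreal (exp (\<theta> * (x + z)\<^sup>2)) \<partial>lborel)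
      = (\<integral>\<^sup>+z. ennreal c * ennreal (normal_density \<mu> (\<sigma> / sqrt D) z) \<partial>lborel)"
    using eq c by (simp add: ennreal_mult[symmetric])
  also have "\<dots> = ennreal c * (\<integral>\<^sup>+z. ennreal (normal_density \<mu> (\<sigma> / sqrt D) z) \<partial>lborel)"
    by (rule nn_integral_cmult) simp
  also have "(\<integral>\<^sup>+z. ennreal (normal_density \<mu> (\<sigma> / sqrt D) z) \<partial>lborel) = 1"
  proof -
    have "prob_space (density lborel (normal_density \<mu> (\<sigma> / sqrt D)))"
      using assms(1) D by (intro prob_space_normal_density) simp
    from prob_space.emeasure_space_1[OF this] show ?thesis
      by (simp add: emeasure_density)
  qed
  finally show ?thesis by (simp add: c_def D_def)
qed

text \<open>Passes from the sorted lists in \<open>brownian_motion\<close> to a sequence of times: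
  the list \<open>s 0, ..., s m\<close> has \<open>m\<close> increments, and its entries are
  nonnegative because \<open>s\<close> increases from 0.\<close>

lemma brownian_motion_sequence_indep:
  fixes s :: "nat \<Rightarrow> real"
  assumes bm: "brownian_motion M B" and s: "strict_mono s" "s 0 = 0"
  shows "prob_space.indep_vars M (\<lambda>_. borel) (\<lambda>i \<omega>. B (s (Suc i)) \<omega> - B (s i) \<omega>) {..<m}"
proof -
  interpret prob_space M using bm by (simp add: brownian_motion_def)
  define ts where "ts = map s [0..<Suc m]"
  have "sorted_wrt (<) ts"
    unfolding ts_def sorted_wrt_map
    by (rule sorted_wrt_mono_rel[OF _ sorted_wrt_upt]) (use s in \<open>auto simp: strict_mono_def\<close>)
  moreover have "\<forall>x\<in>set ts. 0 \<le> x"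
    using strict_mono_less_eq[OF s(1), of 0] by (auto simp: ts_def s(2))
  ultimately have "indep_vars (\<lambda>_. borel) (\<lambda>i \<omega>. B (ts ! Suc i) \<omega> - B (ts ! i) \<omega>) {..<length ts - 1}"
    using bm by (auto simp: brownian_motion_def)
  moreover have "length ts - 1 = m" by (simp add: ts_def)
  moreover have "ts ! i = s i" if "i \<le> m" for i
    using that unfolding ts_def by (subst nth_map) (auto simp del: upt_Suc)
  ultimately show ?thesis
    by (subst indep_vars_cong[OF refl _ refl,
          where Y = "\<lambda>i \<omega>. B (ts ! Suc i) \<omega> - B (ts ! i) \<omega>"]) auto
qed

text \<open>This is the Markov property in the form needed to integrate out the last step. The path
  up to \<open>s m\<close> consists of partial sums of the first \<open>m\<close> increments, hence
  is independent of the next one; the joint law is a product, and Tonelli applies.\<close>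

lemma nn_integral_brownian_increment:
  fixes s :: "nat \<Rightarrow> real" and g :: "(nat \<Rightarrow> real) \<times> real \<Rightarrow> ennreal"
  assumes bm: "brownian_motion M B" and s: "strict_mono s" "s 0 = 0"
    and g[measurable]: "g \<in> borel_measurable (PiM {..m} (\<lambda>_. borel) \<Otimes>\<^sub>M borel)"
  shows "(\<integral>\<^sup>+\<omega>. g (\<lambda>i\<in>{..m}. B (s i) \<omega>, B (s (Suc m)) \<omega> - B (s m) \<omega>) \<partial>M)
    = (\<integral>\<^sup>+\<omega>. \<integral>\<^sup>+z. ennreal (normal_density 0 (sqrt (s (Suc m) - s m)) z)
         * g (\<lambda>i\<in>{..m}. B (s i) \<omega>, z) \<partial>lborel \<partial>M)"
proof -
  interpret prob_space M using bm by (simp add: brownian_motion_def)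
  define D where "D = (\<lambda>i \<omega>. B (s (Suc i)) \<omega> - B (s i) \<omega>)"
  define G where "G = (\<lambda>\<omega>. \<lambda>i\<in>{..m}. B (s i) \<omega>)"
  let ?P = "PiM {..m} (\<lambda>_. borel) :: (nat \<Rightarrow> real) measure"
  let ?Q = "PiM {m} (\<lambda>_. borel) :: (nat \<Rightarrow> real) measure"
  \<comment> \<open>The next increment is kept as a function on the index set \<open>{m}\<close>,
    the form in which \<open>indep_var_restrict\<close> delivers it; it is evaluated at
    \<open>m\<close> below.\<close>
  define E where "E = (\<lambda>\<omega>. \<lambda>i\<in>{m}. D i \<omega>)"
  let ?N = "density lborel (\<lambda>x. ennreal (normal_density 0 (sqrt (s (Suc m) - s m)) x))"
  have s0: "s i \<ge> 0" for i using strict_mono_less_eq[OF s(1), of 0] by (simp add: s(2))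
  have B0: "B (s 0) \<omega> = 0" if "\<omega> \<in> space M" for \<omega>
    using bm that by (simp add: brownian_motion_def s(2))
  have [measurable]: "B (s i) \<in> borel_measurable M" for i
    using bm s0 by (simp add: brownian_motion_def)
  have [measurable]: "D i \<in> borel_measurable M" for i unfolding D_def by measurable
  have [measurable]: "G \<in> measurable M ?P"
    unfolding G_def by (rule measurable_restrict) simp
  have [measurable]: "E \<in> measurable M ?Q"
    unfolding E_def by (rule measurable_restrict) simp
  have "indep_vars (\<lambda>_. borel) D {..<Suc m}"
    unfolding D_def by (rule brownian_motion_sequence_indep[OF bm s])
  from indep_var_restrict[OF this, of "{..<m}" "{m}"]
  have "indep_var (PiM {..<m} (\<lambda>_. borel)) (\<lambda>\<omega>. restrict (\<lambda>i. D i \<omega>) {..<m})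
     (PiM {m} (\<lambda>_. borel)) (\<lambda>\<omega>. restrict (\<lambda>i. D i \<omega>) {m})" by auto
  from indep_var_compose[OF this, of "\<lambda>d. \<lambda>i\<in>{..m}. \<Sum>j<i. d j" ?P "\<lambda>d. d" ?Q]
  have iv: "indep_var ?P ((\<lambda>d. \<lambda>i\<in>{..m}. \<Sum>j<i. d j) \<circ> (\<lambda>\<omega>. restrict (\<lambda>i. D i \<omega>) {..<m}))
     ?Q ((\<lambda>d. d) \<circ> (\<lambda>\<omega>. restrict (\<lambda>i. D i \<omega>) {m}))"
  proof -
    have "(\<lambda>d. \<lambda>i\<in>{..m}. \<Sum>j<i. d j) \<in> measurable (PiM {..<m} (\<lambda>_. borel :: real measure)) ?P"
      by (rule measurable_restrict, rule borel_measurable_sum, rule measurable_component_singleton) auto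
    then show ?thesis
      by (rule \<open>\<lbrakk>_ \<in> _; _ \<in> _\<rbrakk> \<Longrightarrow> _\<close>) simp
  qed
  have e2: "(\<lambda>d. d) \<circ> (\<lambda>\<omega>. restrict (\<lambda>i. D i \<omega>) {m}) = E" by (auto simp: E_def)
  have tel: "(\<Sum>j<i. D j \<omega>) = B (s i) \<omega>" if "\<omega> \<in> space M" for i \<omega>
    using B0[OF that] by (induction i) (auto simp: D_def)
  \<comment> \<open>The partial sums recover the path only on \<open>space M\<close>, where
    \<open>B 0\<close> vanishes, so it is the laws, not the maps, that are identified next.\<close>
  have e1: "((\<lambda>d. \<lambda>i\<in>{..m}. \<Sum>j<i. d j) \<circ> (\<lambda>\<omega>. restrict (\<lambda>i. D i \<omega>) {..<m})) \<omega> = G \<omega>"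
    if "\<omega> \<in> space M" for \<omega>
    using tel[OF that, symmetric] by (auto simp: G_def fun_eq_iff intro!: sum.cong)
  have dG: "distr M ?P ((\<lambda>d. \<lambda>i\<in>{..m}. \<Sum>j<i. d j) \<circ> (\<lambda>\<omega>. restrict (\<lambda>i. D i \<omega>) {..<m})) = distr M ?P G"
    by (rule distr_cong) (use e1 in auto)
  have dP: "distr M (?P \<Otimes>\<^sub>M ?Q) (\<lambda>\<omega>. (((\<lambda>d. \<lambda>i\<in>{..m}. \<Sum>j<i. d j) \<circ> (\<lambda>\<omega>. restrict (\<lambda>i. D i \<omega>) {..<m})) \<omega>, E \<omega>))
     = distr M (?P \<Otimes>\<^sub>M ?Q) (\<lambda>\<omega>. (G \<omega>, E \<omega>))"
    by (rule distr_cong) (use e1 in auto)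
  have dd: "distr M borel (D m) = ?N"
  proof -
    have "distributed M lborel (D m) (\<lambda>x. ennreal (normal_density 0 (sqrt (s (Suc m) - s m)) x))"
      using bm s0[of m] strict_monoD[OF s(1), of m "Suc m"] by (simp add: brownian_motion_def D_def)
    then have "distr M lborel (D m) = ?N" by (simp add: distributed_def)
    moreover have "distr M lborel (D m) = distr M borel (D m)" by (rule distr_cong) auto
    ultimately show ?thesis by simp
  qed
  have pr: "distr M ?P G \<Otimes>\<^sub>M distr M ?Q E = distr M (?P \<Otimes>\<^sub>M ?Q) (\<lambda>\<omega>. (G \<omega>, E \<omega>))"
    using iv[unfolded indep_var_distribution_eq e2] dG dP by simp
  interpret E: prob_space "distr M ?Q E" by (rule prob_space_distr) simp
  have gm[measurable]: "(\<lambda>(x, f). g (x, f m)) \<in> borel_measurable (?P \<Otimes>\<^sub>M ?Q)"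
    by measurable
  have gm': "(\<lambda>(x, f). g (x, f m)) \<in> borel_measurable (distr M ?P G \<Otimes>\<^sub>M distr M ?Q E)"
    unfolding pr using gm by simp
  have "(\<integral>\<^sup>+\<omega>. g (G \<omega>, D m \<omega>) \<partial>M) = (\<integral>\<^sup>+x. (case x of (x, f) \<Rightarrow> g (x, f m)) \<partial>(distr M ?P G \<Otimes>\<^sub>M distr M ?Q E))"
    unfolding pr by (subst nn_integral_distr) (auto simp: E_def)
  also have "\<dots> = (\<integral>\<^sup>+x. \<integral>\<^sup>+f. g (x, f m) \<partial>distr M ?Q E \<partial>distr M ?P G)"
    using E.nn_integral_fst[symmetric, OF gm'] by simp
  also have "\<dots> = (\<integral>\<^sup>+\<omega>. \<integral>\<^sup>+f. g (G \<omega>, f m) \<partial>distr M ?Q E \<partial>M)"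
  proof (rule nn_integral_distr)
    show "(\<lambda>x. \<integral>\<^sup>+f. g (x, f m) \<partial>distr M ?Q E) \<in> borel_measurable (distr M ?P G)"
      using E.borel_measurable_nn_integral_fst[OF gm'] by simp
  qed simp
  also have "\<dots> = (\<integral>\<^sup>+\<omega>. \<integral>\<^sup>+z. ennreal (normal_density 0 (sqrt (s (Suc m) - s m)) z)
         * g (G \<omega>, z) \<partial>lborel \<partial>M)"
  proof (rule nn_integral_cong)
    fix \<omega> assume "\<omega> \<in> space M"
    then have sp: "G \<omega> \<in> space ?P" by (rule measurable_space[OF \<open>G \<in> measurable M ?P\<close>])
    then have [measurable]: "(\<lambda>z. g (G \<omega>, z)) \<in> borel_measurable borel" by measurable
    have "(\<integral>\<^sup>+f. g (G \<omega>, f m) \<partial>distr M ?Q E) = (\<integral>\<^sup>+\<omega>'. g (G \<omega>, D m \<omega>') \<partial>M)"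
      by (subst nn_integral_distr) (auto simp: E_def)
    also have "\<dots> = (\<integral>\<^sup>+z. g (G \<omega>, z) \<partial>?N)"
      unfolding dd[symmetric] by (subst nn_integral_distr) auto
    also have "\<dots> = (\<integral>\<^sup>+z. ennreal (normal_density 0 (sqrt (s (Suc m) - s m)) z)
         * g (G \<omega>, z) \<partial>lborel)"
      by (subst nn_integral_density) auto
    finally show "(\<integral>\<^sup>+f. g (G \<omega>, f m) \<partial>distr M ?Q E) = (\<integral>\<^sup>+z. ennreal (normal_density 0 (sqrt (s (Suc m) - s m)) z)
         * g (G \<omega>, z) \<partial>lborel)" .
  qed
  finally show ?thesis by (simp add: G_def D_def)
qed

section \<open>Exponential moments along a geometric grid\<close>

text \<open>
  The left Riemann sum of \<open>B\<^sub>s\<^sup>2 / s\<^sup>2\<close> over the grid \<open>1, q, \<dots>, q^m\<close>: since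
  \<open>q^(i+1) - q^i = (q - 1) q^i\<close>, one of the two powers \<open>q^i\<close> in the denominator cancels.
\<close>

definition geometric_sum :: "(real \<Rightarrow> 'a \<Rightarrow> real) \<Rightarrow> real \<Rightarrow> nat \<Rightarrow> 'a \<Rightarrow> real" where
  "geometric_sum B q m \<omega> = (q - 1) * (\<Sum>i<m. (B (q ^ i) \<omega>)\<^sup>2 / q ^ i)"

text \<open>The \<open>ennreal\<close> integral makes finiteness a conclusion instead of a side
  condition. The point \<open>q ^ m\<close> is absent from \<open>geometric_sum B q m\<close>, so
  the last increment enters through the terminal factor only.\<close>

definition tilted_moment ::
  "'a measure \<Rightarrow> (real \<Rightarrow> 'a \<Rightarrow> real) \<Rightarrow> real \<Rightarrow> real \<Rightarrow> real \<Rightarrow> nat \<Rightarrow> ennreal" where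
  "tilted_moment M B q w \<theta> m =
     (\<integral>\<^sup>+\<omega>. ennreal (exp (\<theta> * ((B (q ^ m) \<omega>)\<^sup>2 / q ^ m) + w * geometric_sum B q m \<omega>)) \<partial>M)"

lemma brownian_motion_measurable:
  "brownian_motion M B \<Longrightarrow> 0 \<le> t \<Longrightarrow> B t \<in> borel_measurable M"
  by (simp add: brownian_motion_def)

lemma geometric_sum_measurable:
  assumes "brownian_motion M B" "q \<ge> 0"
  shows "geometric_sum B q m \<in> borel_measurable M"
proof -
  have [measurable]: "B (q ^ i) \<in> borel_measurable M" for i
    using assms by (simp add: brownian_motion_measurable)
  show ?thesis unfolding geometric_sum_def by measurable
qed

lemma geometric_sum_nonneg: "q \<ge> 1 \<Longrightarrow> geometric_sum B q m \<omega> \<ge> 0"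
  by (auto simp: geometric_sum_def intro!: mult_nonneg_nonneg sum_nonneg)

text \<open>The sum is empty and \<open>B 1\<close> is standard normal, so this is the moment
  generating function of a chi-squared variable.\<close>

lemma tilted_moment_0:
  assumes bm: "brownian_motion M B" and "2 * \<theta> < 1"
  shows "tilted_moment M B q w \<theta> 0 = ennreal (1 / sqrt (1 - 2 * \<theta>))"
proof -
  interpret prob_space M using bm by (simp add: brownian_motion_def)
  have [measurable]: "B 1 \<in> borel_measurable M" using bm by (simp add: brownian_motion_measurable)
  have "distributed M lborel (\<lambda>\<omega>. B 1 \<omega> - B 0 \<omega>) (\<lambda>x. ennreal (normal_density 0 (sqrt (1 - 0)) x))"
    using bm unfolding brownian_motion_def by (metis order_refl zero_less_one)
  then have d: "distr M lborel (\<lambda>\<omega>. B 1 \<omega> - B 0 \<omega>) = density lborel (\<lambda>x. ennreal (normal_density 0 1 x))"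
    by (simp add: distributed_def)
  have "distr M lborel (\<lambda>\<omega>. B 1 \<omega> - B 0 \<omega>) = distr M borel (B 1)"
    by (rule distr_cong) (use bm in \<open>auto simp: brownian_motion_def\<close>)
  then have d': "distr M borel (B 1) = density lborel (\<lambda>x. ennreal (normal_density 0 1 x))"
    using d by simp
  have "tilted_moment M B q w \<theta> 0 = (\<integral>\<^sup>+x. ennreal (exp (\<theta> * x\<^sup>2)) \<partial>distr M borel (B 1))"
    unfolding tilted_moment_def by (subst nn_integral_distr) (auto simp: geometric_sum_def)
  also have "\<dots> = (\<integral>\<^sup>+z. ennreal (normal_density 0 1 z) * ennreal (exp (\<theta> * (0 + z)\<^sup>2)) \<partial>lborel)"
    unfolding d' by (subst nn_integral_density) auto
  also have "\<dots> = ennreal (1 / sqrt (1 - 2 * \<theta>))"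
    using assms(2) by (subst nn_integral_normal_density_exp_square) auto
  finally show ?thesis .
qed

text \<open>The last increment has variance \<open>q ^ m * (q - 1)\<close>. Integrating it out
  leaves an exponential of the square of \<open>B (q ^ m)\<close>, which merges with the last term
  of the Riemann sum into a new terminal factor.\<close>

lemma tilted_moment_Suc:
  assumes bm: "brownian_motion M B" and q: "q > 1" and D: "2 * \<theta> * ((q - 1) / q) < 1"
  shows "tilted_moment M B q w \<theta> (Suc m) = ennreal (1 / sqrt (1 - 2 * \<theta> * ((q - 1) / q)))
    * tilted_moment M B q w (\<theta> / (q * (1 - 2 * \<theta> * ((q - 1) / q))) + w * (q - 1)) m"
proof -
  \<comment> \<open>Time 0 is prepended so that \<open>s 0 = 0\<close>; the grid point
    \<open>q ^ j\<close> therefore has index \<open>Suc j\<close>.\<close>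
  define s where "s i = (case i of 0 \<Rightarrow> 0 | Suc j \<Rightarrow> q ^ j)" for i
  have s: "strict_mono s" "s 0 = 0" "s (Suc i) = q ^ i" for i
    using q by (auto simp: strict_mono_Suc_iff s_def split: nat.split)
  define D where "D = 1 - 2 * \<theta> * ((q - 1) / q)"
  have Dp: "D > 0" using D by (simp add: D_def)
  \<comment> \<open>The whole Riemann sum as a function of the past: it includes the term at
    \<open>q ^ m\<close>, which does not depend on the last increment.\<close>
  define R where "R x = w * ((q - 1) * (\<Sum>i<Suc m. (x (Suc i))\<^sup>2 / q ^ i))" for x :: "nat \<Rightarrow> real"
  define g where "g = (\<lambda>(x, z). ennreal (exp (\<theta> * ((x (Suc m) + z)\<^sup>2 / q ^ Suc m) + R x)))"
  have cm: "(\<lambda>x. x i) \<in> borel_measurable (PiM {..Suc m} (\<lambda>_. borel :: real measure))"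
    if "i \<le> Suc m" for i
    using that by (intro measurable_component_singleton) auto
  have [measurable]: "R \<in> borel_measurable (PiM {..Suc m} (\<lambda>_. borel))"
    unfolding R_def
    by (intro borel_measurable_times borel_measurable_sum borel_measurable_divide
        borel_measurable_power cm borel_measurable_const) auto
  have [measurable]: "(\<lambda>x. x (Suc m)) \<in> borel_measurable (PiM {..Suc m} (\<lambda>_. borel :: real measure))"
    by (rule cm) simp
  have gm: "g \<in> borel_measurable (PiM {..Suc m} (\<lambda>_. borel) \<Otimes>\<^sub>M borel)"
    unfolding g_def by measurable
  let ?G = "\<lambda>\<omega>. \<lambda>i\<in>{..Suc m}. B (s i) \<omega>"
  have RG: "R (?G \<omega>) = w * geometric_sum B q (Suc m) \<omega>" for \<omega>
    unfolding R_def geometric_sum_def by (simp add: s)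
  have inner: "(\<integral>\<^sup>+z. ennreal (normal_density 0 (sqrt (s (Suc (Suc m)) - s (Suc m))) z) * g (?G \<omega>, z) \<partial>lborel)
     = ennreal (1 / sqrt D) * ennreal (exp ((\<theta> / (q * D) + w * (q - 1)) * ((B (q ^ m) \<omega>)\<^sup>2 / q ^ m)
         + w * geometric_sum B q m \<omega>))" for \<omega>
  proof -
    define b where "b = B (q ^ m) \<omega>"
    define v where "v = sqrt (s (Suc (Suc m)) - s (Suc m))"
    have v2: "v\<^sup>2 = q ^ m * (q - 1)" and vp: "v > 0"
      using q by (auto simp: v_def s(3) algebra_simps)
    \<comment> \<open>The exponent relative to the square of \<open>B\<close> without
      normalisation.\<close>
    define \<eta> where "\<eta> = \<theta> / q ^ Suc m"
    have \<eta>: "2 * \<eta> * v\<^sup>2 = 2 * \<theta> * ((q - 1) / q)"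
      using q by (simp add: \<eta>_def v2)
    have "(\<integral>\<^sup>+z. ennreal (normal_density 0 v z) * g (?G \<omega>, z) \<partial>lborel)
        = (\<integral>\<^sup>+z. ennreal (exp (R (?G \<omega>))) * (ennreal (normal_density 0 v z) * ennreal (exp (\<eta> * (b + z)\<^sup>2))) \<partial>lborel)"
      by (intro nn_integral_cong)
         (simp add: g_def s(3) b_def \<eta>_def exp_add ennreal_mult mult_ac)
    also have "\<dots> = ennreal (exp (R (?G \<omega>))) * ennreal (exp (\<eta> * b\<^sup>2 / D) / sqrt D)"
      using nn_integral_normal_density_exp_square[OF vp, of \<eta> b] D \<eta>
      by (subst nn_integral_cmult) (auto simp: D_def)
    also have "\<dots> = ennreal (1 / sqrt D) * ennreal (exp (R (?G \<omega>) + \<eta> * b\<^sup>2 / D))"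
      using Dp by (simp add: exp_add ennreal_mult[symmetric] mult_ac)
    also have "R (?G \<omega>) + \<eta> * b\<^sup>2 / D = (\<theta> / (q * D) + w * (q - 1)) * (b\<^sup>2 / q ^ m) + w * geometric_sum B q m \<omega>"
      unfolding RG \<eta>_def geometric_sum_def b_def
      by (simp add: algebra_simps add_divide_distrib diff_divide_distrib)
    finally show ?thesis unfolding v_def b_def .
  qed
  have [measurable]: "B (q ^ i) \<in> borel_measurable M" for i
    using bm q by (simp add: brownian_motion_measurable)
  have [measurable]: "geometric_sum B q m \<in> borel_measurable M"
    using bm q by (simp add: geometric_sum_measurable)
  have "tilted_moment M B q w \<theta> (Suc m) = (\<integral>\<^sup>+\<omega>. g (?G \<omega>, B (s (Suc (Suc m))) \<omega> - B (s (Suc m)) \<omega>) \<partial>M)"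
    unfolding tilted_moment_def g_def by (simp add: RG) (simp add: s(3))
  also have "\<dots> = (\<integral>\<^sup>+\<omega>. \<integral>\<^sup>+z. ennreal (normal_density 0 (sqrt (s (Suc (Suc m)) - s (Suc m))) z)
         * g (?G \<omega>, z) \<partial>lborel \<partial>M)"
    by (rule nn_integral_brownian_increment[OF bm s(1,2) gm])
  also have "\<dots> = ennreal (1 / sqrt D) * tilted_moment M B q w (\<theta> / (q * D) + w * (q - 1)) m"
    unfolding inner tilted_moment_def by (rule nn_integral_cmult) measurable
  finally show ?thesis by (simp add: D_def)
qed

section \<open>The fixed point of the exponent recursion and bounds along its orbits\<close>

text \<open>
  By \<open>tilted_moment_Suc\<close>, one step of the grid maps the exponent \<open>\<theta>\<close> to
  \<open>\<theta> / (q - 2 \<theta> (q - 1)) + w (q - 1)\<close>. The weight below is the \<open>w\<close> for which \<open>\<alpha>\<close> is a fixed point;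
  each step then contributes the factor \<open>tilt_rate \<alpha> q\<close> to the power \<open>-1/2\<close>.
\<close>

definition tilt_weight :: "real \<Rightarrow> real \<Rightarrow> real" where
  "tilt_weight \<alpha> q = \<alpha> * (1 - 2 * \<alpha>) / (1 + (q - 1) * (1 - 2 * \<alpha>))"

definition tilt_rate :: "real \<Rightarrow> real \<Rightarrow> real" where
  "tilt_rate \<alpha> q = 1 - 2 * \<alpha> * ((q - 1) / q)"

context
  fixes M :: "'a measure" and B :: "real \<Rightarrow> 'a \<Rightarrow> real" and q \<alpha> p w A :: real
  assumes bm: "brownian_motion M B" and q: "q > 1" and \<alpha>: "\<alpha> < 1 / 4"
  defines "p \<equiv> (q - 1) / q" and "A \<equiv> tilt_rate \<alpha> q" and "w \<equiv> tilt_weight \<alpha> q"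
begin

lemma tilt_rate_eq: "A = 1 - 2 * \<alpha> * p"
  by (simp add: A_def p_def tilt_rate_def)

text \<open>Here \<open>p\<close> is the share of the last increment in the variance at the end of a
  step. The last equation says that \<open>\<alpha>\<close> is fixed by the exponent recursion;
  \<open>q * A\<close> is the denominator of \<open>tilt_weight \<alpha> q\<close>.\<close>

lemma tilt_rate_weight: "0 < p" "p < 1" "q * (1 - p) = 1" "A > 0" "w * (q - 1) = \<alpha> - \<alpha> / (q * A)"
proof -
  show p: "0 < p" "p < 1" "q * (1 - p) = 1" using q by (auto simp: p_def field_simps)
  have qA: "q * A = 1 + (q - 1) * (1 - 2 * \<alpha>)" using q by (simp add: tilt_rate_eq p_def field_simps)
  have "(q - 1) * (1 - 2 * \<alpha>) > 0" using q \<alpha> by simp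
  then have qp: "q * A > 0" unfolding qA by simp
  then show "A > 0" using q by (simp add: zero_less_mult_iff)
  have "w * (q * A) = \<alpha> * (1 - 2 * \<alpha>)" using qp unfolding qA w_def tilt_weight_def by simp
  then have "(w * (q - 1)) * (q * A) = (q - 1) * (\<alpha> * (1 - 2 * \<alpha>))" by (simp add: mult_ac)
  also have "\<dots> = \<alpha> * (q * A) - \<alpha>" unfolding qA by (simp add: algebra_simps)
  also have "\<dots> = (\<alpha> - \<alpha> / (q * A)) * (q * A)" using qp by (auto simp: left_diff_distrib)
  finally have "(w * (q - 1)) * (q * A) = (\<alpha> - \<alpha> / (q * A)) * (q * A)" .
  then show "w * (q - 1) = \<alpha> - \<alpha> / (q * A)" using qp by auto
qed

text \<open>The recursion is written for the deviation from the fixed point, which a step divides by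
  \<open>q * A * D\<close>. Exponents up to 1/4 give \<open>A\<close> and \<open>D\<close> at least
  \<open>1 - p / 2\<close>, whose square is at least \<open>1 - p = 1 / q\<close>; so the deviation
  never grows and exponents never leave the admissible range.\<close>

lemma tilted_moment_step:
  assumes th: "\<theta> \<le> 1 / 4"
  defines "D \<equiv> 1 - 2 * \<theta> * p"
  shows "D > 0" and "tilted_moment M B q w \<theta> (Suc m)
    = ennreal (1 / sqrt D) * tilted_moment M B q w (\<alpha> + (\<theta> - \<alpha>) / (q * A * D)) m"
    and "q * A * D \<ge> 1"
proof -
  have "2 * \<theta> * p \<le> 1 / 2 * p" using th tilt_rate_weight by (intro mult_right_mono) auto
  then have D1: "D \<ge> 1 - p / 2" by (simp add: D_def)
  then show Dp: "D > 0" using tilt_rate_weight by linarith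
  have "2 * \<alpha> * p \<le> 1 / 2 * p" using \<alpha> tilt_rate_weight by (intro mult_right_mono) auto
  then have A1: "A \<ge> 1 - p / 2" by (simp add: tilt_rate_eq)
  have "(1 - p / 2) * (1 - p / 2) \<le> A * D" using A1 D1 tilt_rate_weight by (intro mult_mono) auto
  moreover have "1 - p \<le> (1 - p / 2) * (1 - p / 2)" by (simp add: algebra_simps)
  ultimately have "q * (1 - p) \<le> q * (A * D)" using q by (intro mult_left_mono) auto
  then show "q * A * D \<ge> 1" using tilt_rate_weight(3) by (simp add: mult_ac)
  have "\<theta> / (q * D) + w * (q - 1) = \<alpha> + (\<theta> * A - \<alpha> * D) / (q * A * D)"
    unfolding tilt_rate_weight(5) using Dp tilt_rate_weight(4) q by (simp add: field_simps)
  also have "\<theta> * A - \<alpha> * D = \<theta> - \<alpha>" by (simp add: tilt_rate_eq D_def algebra_simps)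
  finally show "tilted_moment M B q w \<theta> (Suc m)
    = ennreal (1 / sqrt D) * tilted_moment M B q w (\<alpha> + (\<theta> - \<alpha>) / (q * A * D)) m"
    using tilted_moment_Suc[OF bm q, of \<theta> w m] Dp by (simp add: D_def p_def)
qed

text \<open>At deviation 0 the exponent stays put and \<open>D = A\<close>, so every step
  contributes the same factor.\<close>

lemma tilted_moment_eigen:
  "tilted_moment M B q w \<alpha> m = ennreal (1 / sqrt (A ^ m) * (1 / sqrt (1 - 2 * \<alpha>)))"
proof (induction m)
  case 0
  then show ?case using tilted_moment_0[OF bm] \<alpha> by simp
next
  case (Suc m)
  have "tilted_moment M B q w \<alpha> (Suc m) = ennreal (1 / sqrt A) * tilted_moment M B q w \<alpha> m"
    using tilted_moment_step(2)[of \<alpha> m] \<alpha> by (simp add: tilt_rate_eq)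
  then show ?case
    using tilt_rate_weight \<alpha> by (simp add: Suc ennreal_mult[symmetric] real_sqrt_mult mult_ac)
qed

text \<open>
  Under the law tilted by the eigenfunction at \<open>\<alpha>\<close>, the variable \<open>B(q^m) / sqrt (q^m)\<close> is again a centred
  Gaussian, and \<open>V\<close> is a bound for its variance that is preserved by every step of the grid.
\<close>

lemma tilted_moment_le:
  assumes V: "V * (1 - 4 * \<alpha>) \<ge> 1" "V * (1 - 2 * \<alpha>) \<ge> 1" "V * (1 - 4 * \<alpha>) < 2"
    and "\<alpha> \<le> \<theta>" "\<theta> \<le> 1 / 4"
  shows "tilted_moment M B q w \<theta> m
    \<le> ennreal (1 / sqrt (A ^ m) * (1 / sqrt (1 - 2 * \<alpha>)) * (1 / sqrt (1 - 2 * (\<theta> - \<alpha>) * V)))"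
  using assms(4,5)
proof (induction m arbitrary: \<theta>)
  have "V > 0" using V(1) \<alpha> mult_nonpos_nonneg[of V "1 - 4 * \<alpha>"] by linarith
  \<comment> \<open>The radicand is smallest at the endpoint 1/4, where its positivity is exactly
    \<open>V * (1 - 4 * \<alpha>) < 2\<close>.\<close>
  have pos: "1 - 2 * (\<theta> - \<alpha>) * V > 0" if "\<theta> \<le> 1 / 4" for \<theta>
  proof -
    have "2 * (\<theta> - \<alpha>) * V \<le> 2 * (1 / 4 - \<alpha>) * V" using that \<open>V > 0\<close> by (intro mult_right_mono) auto
    also have "\<dots> < 1" using V(3) by (simp add: algebra_simps)
    finally show ?thesis by simp
  qed
  {
    case 0
    have "(1 - 2 * \<alpha>) * (1 - 2 * (\<theta> - \<alpha>) * V) \<le> 1 - 2 * \<theta>"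
    proof -
      have "2 * (\<theta> - \<alpha>) * 1 \<le> 2 * (\<theta> - \<alpha>) * (V * (1 - 2 * \<alpha>))"
        using V(2) 0 by (intro mult_left_mono) auto
      then show ?thesis by (simp add: algebra_simps)
    qed
    then have "1 / sqrt (1 - 2 * \<theta>) \<le> 1 / sqrt ((1 - 2 * \<alpha>) * (1 - 2 * (\<theta> - \<alpha>) * V))"
      using pos[OF 0(2)] \<alpha> 0 by (intro divide_left_mono real_sqrt_le_mono) auto
    then show ?case
      using tilted_moment_0[OF bm, of \<theta>] 0 by (simp add: real_sqrt_mult ennreal_leI)
  next
    case (Suc m)
    define D where "D = 1 - 2 * \<theta> * p"
    define \<beta> where "\<beta> = (\<theta> - \<alpha>) / (q * A * D)"
    note st = tilted_moment_step[OF Suc.prems(2), folded D_def]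
    have b0: "\<beta> \<ge> 0" using st Suc.prems by (simp add: \<beta>_def)
    have b1: "\<beta> \<le> \<theta> - \<alpha>" unfolding \<beta>_def using st(3) Suc.prems by (simp add: divide_le_eq mult_le_cancel_left1)
    have ba: "\<alpha> + \<beta> \<le> 1 / 4" using b1 Suc.prems by simp
    have pb: "1 - 2 * \<beta> * V > 0" using pos[OF ba] by simp
    \<comment> \<open>The combination of the two lower conditions on \<open>V\<close> with weights
      \<open>1 - p\<close> and \<open>p\<close>, the second condition being first multiplied by
      \<open>1 - 2 * \<alpha>\<close>.\<close>
    have lin: "V * (1 - 4 * \<alpha> + 4 * \<alpha>\<^sup>2 * p) \<ge> 1 - 2 * \<alpha> * p"
    proof -
      have 1: "(1 - p) * (V * (1 - 4 * \<alpha>)) \<ge> (1 - p) * 1"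
        using V tilt_rate_weight by (intro mult_left_mono) auto
      have "(1 - 2 * \<alpha>) * (V * (1 - 2 * \<alpha>)) \<ge> (1 - 2 * \<alpha>) * 1"
        using V \<alpha> by (intro mult_left_mono) auto
      then have 2: "p * ((1 - 2 * \<alpha>) * (V * (1 - 2 * \<alpha>))) \<ge> p * ((1 - 2 * \<alpha>) * 1)"
        using tilt_rate_weight(1) by (rule mult_left_mono[OF _ less_imp_le])
      from 1 2 show ?thesis by (simp add: algebra_simps power2_eq_square)
    qed
    \<comment> \<open>This is the invariance of the variance bound under one step. After
      multiplication by \<open>A\<close> the difference of the two sides factors, with
      \<open>\<theta> - \<alpha>\<close> as one factor and the difference in \<open>lin\<close> as
      another.\<close>
    have "A * (1 - 2 * (\<theta> - \<alpha>) * V) \<le> D * (1 - 2 * \<beta> * V)"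
    proof -
      have bD: "\<beta> * D * A = (\<theta> - \<alpha>) * (1 - p)"
      proof -
        have "\<beta> * D * A * q = \<theta> - \<alpha>" using st q tilt_rate_weight by (simp add: \<beta>_def)
        then have "(\<beta> * D * A) * (q * (1 - p)) = (\<theta> - \<alpha>) * (1 - p)" by (metis mult.assoc)
        then show ?thesis by (simp add: tilt_rate_weight(3))
      qed
      have AA: "A * A - (1 - p) = p * (1 - 4 * \<alpha> + 4 * \<alpha>\<^sup>2 * p)"
        by (simp add: tilt_rate_eq algebra_simps power2_eq_square)
      have "A * (D * (1 - 2 * \<beta> * V) - A * (1 - 2 * (\<theta> - \<alpha>) * V))
          = A * (D - A) - 2 * V * (\<beta> * D * A) + 2 * V * (\<theta> - \<alpha>) * (A * A)"
        by (simp add: algebra_simps)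
      also have "\<dots> = A * (D - A) + 2 * V * (\<theta> - \<alpha>) * (A * A - (1 - p))"
        unfolding bD by (simp add: algebra_simps)
      also have "A * (D - A) = - (2 * p * (\<theta> - \<alpha>)) * A" by (simp add: tilt_rate_eq D_def algebra_simps)
      also have "- (2 * p * (\<theta> - \<alpha>)) * A + 2 * V * (\<theta> - \<alpha>) * (A * A - (1 - p))
          = 2 * p * (\<theta> - \<alpha>) * (V * (1 - 4 * \<alpha> + 4 * \<alpha>\<^sup>2 * p) - A)"
        unfolding AA by (simp add: algebra_simps)
      also have "\<dots> \<ge> 0"
        using lin Suc.prems tilt_rate_weight(1) by (intro mult_nonneg_nonneg) (auto simp: tilt_rate_eq)
      finally show ?thesis using tilt_rate_weight(4) by (simp add: zero_le_mult_iff)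
    qed
    then have "1 / sqrt (D * (1 - 2 * \<beta> * V)) \<le> 1 / sqrt (A * (1 - 2 * (\<theta> - \<alpha>) * V))"
      using pos[OF Suc.prems(2)] st(1) pb tilt_rate_weight(4)
      by (intro divide_left_mono real_sqrt_le_mono mult_pos_pos) auto
    then have le: "1 / sqrt D * (1 / sqrt (1 - 2 * \<beta> * V)) \<le> 1 / sqrt A * (1 / sqrt (1 - 2 * (\<theta> - \<alpha>) * V))"
      by (simp add: real_sqrt_mult)
    have "tilted_moment M B q w \<theta> (Suc m) = ennreal (1 / sqrt D) * tilted_moment M B q w (\<alpha> + \<beta>) m"
      using st(2) by (simp add: \<beta>_def)
    also have "\<dots> \<le> ennreal (1 / sqrt D) * ennreal (1 / sqrt (A ^ m) * (1 / sqrt (1 - 2 * \<alpha>)) * (1 / sqrt (1 - 2 * \<beta> * V)))"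
      using Suc.IH[of "\<alpha> + \<beta>"] b0 ba by (intro mult_left_mono) auto
    also have "\<dots> = ennreal ((1 / sqrt (A ^ m) * (1 / sqrt (1 - 2 * \<alpha>))) * (1 / sqrt D * (1 / sqrt (1 - 2 * \<beta> * V))))"
      using st(1) tilt_rate_weight(4) pb \<alpha> by (subst ennreal_mult[symmetric]) (auto simp: mult_ac)
    also have "\<dots> \<le> ennreal ((1 / sqrt (A ^ m) * (1 / sqrt (1 - 2 * \<alpha>))) * (1 / sqrt A * (1 / sqrt (1 - 2 * (\<theta> - \<alpha>) * V))))"
      using tilt_rate_weight(4) \<alpha> by (intro ennreal_leI mult_left_mono le) auto
    also have "\<dots> = ennreal (1 / sqrt (A ^ Suc m) * (1 / sqrt (1 - 2 * \<alpha>)) * (1 / sqrt (1 - 2 * (\<theta> - \<alpha>) * V)))"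
      by (simp add: real_sqrt_mult mult_ac)
    finally show ?case .
  }
qed

end

section \<open>Limits as the mesh tends to 0\<close>

text \<open>Each cell contributes at most \<open>\<epsilon>\<close> times its length. The separate
  endpoint \<open>b\<close> keeps the continuity hypothesis fixed during the induction on
  \<open>k\<close>.\<close>

lemma left_riemann_sum_error:
  fixes f :: "real \<Rightarrow> real" and s :: "nat \<Rightarrow> real"
  assumes f: "continuous_on {s 0..b} f" and s: "mono s" "\<And>i. i \<le> k \<Longrightarrow> s i \<le> b"
    and mesh: "\<And>i x. i < k \<Longrightarrow> x \<in> {s i..s (Suc i)} \<Longrightarrow> \<bar>f x - f (s i)\<bar> \<le> \<epsilon>"
  shows "\<bar>(\<Sum>i<k. (s (Suc i) - s i) * f (s i)) - integral {s 0..s k} f\<bar> \<le> \<epsilon> * (s k - s 0)"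
  using s(2) mesh
proof (induction k)
  case 0
  then show ?case by simp
next
  case (Suc k)
  have le: "s 0 \<le> s k" "s k \<le> s (Suc k)" using s(1) by (auto simp: mono_def)
  have int: "f integrable_on {s 0..s (Suc k)}"
    using Suc.prems(1)[of "Suc k"] by (intro integrable_continuous_interval continuous_on_subset[OF f]) auto
  have intk: "f integrable_on {s k..s (Suc k)}"
    using Suc.prems(1)[of "Suc k"] le by (intro integrable_continuous_interval continuous_on_subset[OF f]) auto
  have eq: "integral {s 0..s k} f + integral {s k..s (Suc k)} f = integral {s 0..s (Suc k)} f"
    by (rule Henstock_Kurzweil_Integration.integral_combine[OF le int])
  have "\<bar>integral {s k..s (Suc k)} (\<lambda>x. f x - f (s k))\<bar> \<le> integral {s k..s (Suc k)} (\<lambda>_. \<epsilon>)"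
    unfolding real_norm_def[symmetric]
    by (rule integral_norm_bound_integral) (use Suc.prems(2)[of k] intk in \<open>auto intro!: integrable_diff\<close>)
  moreover have "integral {s k..s (Suc k)} (\<lambda>x. f x - f (s k))
      = integral {s k..s (Suc k)} f - (s (Suc k) - s k) * f (s k)"
    using intk le by (subst Henstock_Kurzweil_Integration.integral_diff) auto
  moreover have "\<bar>(\<Sum>i<k. (s (Suc i) - s i) * f (s i)) - integral {s 0..s k} f\<bar> \<le> \<epsilon> * (s k - s 0)"
    using Suc.prems by (intro Suc.IH) auto
  ultimately show ?case
    using eq le by (simp add: algebra_simps)
qed

text \<open>With \<open>L\<close> the logarithm of the final time, the base is
  \<open>1 - 2 * a * L / m\<close> up to terms of order \<open>1 / m^2\<close>.\<close>

lemma tilt_rate_power_tendsto: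
  fixes a L :: real
  shows "(\<lambda>m. tilt_rate a (exp (L / real (Suc m))) ^ Suc m) \<longlonglongrightarrow> exp (- 2 * a * L)"
  unfolding tilt_rate_def by real_asymp

text \<open>Fatou gives only upper bounds for the limit; a bounded moment of order
  \<open>p > 1\<close> gives lower ones. Truncation at \<open>K\<close> converges by domination, and
  the excess costs at most \<open>K powr (1 - p) * C\<close>, which vanishes as \<open>K\<close>
  grows.\<close>

lemma uniformly_integrable_lower_limit:
  fixes f :: "nat \<Rightarrow> 'a \<Rightarrow> real" and g :: "'a \<Rightarrow> real"
  assumes "prob_space M" and [measurable]: "\<And>m. f m \<in> borel_measurable M" "g \<in> borel_measurable M"
    and pos: "\<And>m \<omega>. f m \<omega> \<ge> 0" and lim: "\<And>\<omega>. \<omega> \<in> space M \<Longrightarrow> (\<lambda>m. f m \<omega>) \<longlonglongrightarrow> g \<omega>"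
    and p: "p > 1" and bnd: "\<And>m. (\<integral>\<^sup>+\<omega>. ennreal (f m \<omega> powr p) \<partial>M) \<le> ennreal C"
    and c: "\<And>m. ennreal (c m) \<le> (\<integral>\<^sup>+\<omega>. ennreal (f m \<omega>) \<partial>M)" "c \<longlonglongrightarrow> c0"
  shows "ennreal c0 \<le> (\<integral>\<^sup>+\<omega>. ennreal (g \<omega>) \<partial>M)"
proof -
  interpret prob_space M by fact
  have main: "ennreal c0 \<le> (\<integral>\<^sup>+\<omega>. ennreal (g \<omega>) \<partial>M) + ennreal (K powr (1 - p)) * ennreal C" if K: "K > 0" for K :: real
  proof -
    have "(\<lambda>m. \<integral>\<^sup>+\<omega>. ennreal (min (f m \<omega>) K) \<partial>M) \<longlonglongrightarrow> (\<integral>\<^sup>+\<omega>. ennreal (min (g \<omega>) K) \<partial>M)"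
    proof (rule nn_integral_dominated_convergence[where w = "\<lambda>_. ennreal K"])
      show "AE \<omega> in M. (\<lambda>m. ennreal (min (f m \<omega>) K)) \<longlonglongrightarrow> ennreal (min (g \<omega>) K)"
        using lim by (intro AE_I2 tendsto_ennrealI tendsto_min) auto
    qed (auto simp: ennreal_leI emeasure_space_1)
    then have "(\<lambda>m. (\<integral>\<^sup>+\<omega>. ennreal (min (f m \<omega>) K) \<partial>M) + ennreal (K powr (1 - p)) * ennreal C)
        \<longlonglongrightarrow> (\<integral>\<^sup>+\<omega>. ennreal (min (g \<omega>) K) \<partial>M) + ennreal (K powr (1 - p)) * ennreal C"
      by (intro tendsto_add tendsto_const)
    moreover have "ennreal (c m) \<le> (\<integral>\<^sup>+\<omega>. ennreal (min (f m \<omega>) K) \<partial>M) + ennreal (K powr (1 - p)) * ennreal C" for m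
    proof -
      \<comment> \<open>Above \<open>K\<close>, write the value as a product of its powers
        \<open>1 - p\<close> and \<open>p\<close>; the first exponent is negative, so that power is
        largest at \<open>K\<close>.\<close>
      have "f m \<omega> \<le> min (f m \<omega>) K + K powr (1 - p) * f m \<omega> powr p" for \<omega>
      proof (cases "f m \<omega> \<le> K")
        case False
        then have "K powr (1 - p) * f m \<omega> powr p \<ge> f m \<omega> powr (1 - p) * f m \<omega> powr p"
          using K p by (intro mult_right_mono powr_mono2') auto
        also have "f m \<omega> powr (1 - p) * f m \<omega> powr p = f m \<omega>"
          using False K by (simp add: powr_add[symmetric])
        finally show ?thesis using False K by simp
      qed simp
      then have "ennreal (f m \<omega>) \<le> ennreal (min (f m \<omega>) K) + ennreal (K powr (1 - p)) * ennreal (f m \<omega> powr p)" for \<omega>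
        using pos[of m \<omega>] K by (simp add: ennreal_mult[symmetric] ennreal_plus[symmetric] ennreal_leI del: ennreal_plus)
      then have "(\<integral>\<^sup>+\<omega>. ennreal (f m \<omega>) \<partial>M)
          \<le> (\<integral>\<^sup>+\<omega>. ennreal (min (f m \<omega>) K) + ennreal (K powr (1 - p)) * ennreal (f m \<omega> powr p) \<partial>M)"
        by (intro nn_integral_mono)
      also have "\<dots> = (\<integral>\<^sup>+\<omega>. ennreal (min (f m \<omega>) K) \<partial>M) + ennreal (K powr (1 - p)) * (\<integral>\<^sup>+\<omega>. ennreal (f m \<omega> powr p) \<partial>M)"
        by (subst nn_integral_add) (auto simp: nn_integral_cmult)
      also have "\<dots> \<le> (\<integral>\<^sup>+\<omega>. ennreal (min (f m \<omega>) K) \<partial>M) + ennreal (K powr (1 - p)) * ennreal C"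
        by (intro add_left_mono mult_left_mono bnd) auto
      finally show ?thesis using c(1)[of m] by (rule order_trans[rotated])
    qed
    ultimately have "ennreal c0 \<le> (\<integral>\<^sup>+\<omega>. ennreal (min (g \<omega>) K) \<partial>M) + ennreal (K powr (1 - p)) * ennreal C"
      by (intro LIMSEQ_le[OF tendsto_ennrealI[OF c(2)]]) blast+
    also have "\<dots> \<le> (\<integral>\<^sup>+\<omega>. ennreal (g \<omega>) \<partial>M) + ennreal (K powr (1 - p)) * ennreal C"
      by (intro add_right_mono nn_integral_mono ennreal_leI) simp
    finally show ?thesis .
  qed
  have "(\<lambda>k. real (Suc k) powr (1 - p)) \<longlonglongrightarrow> 0"
    using p by (intro tendsto_neg_powr filterlim_compose[OF filterlim_real_sequentially filterlim_Suc]) auto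
  \<comment> \<open>A negative \<open>C\<close> counts as 0 in \<open>ennreal\<close>;
    \<open>max 0 C\<close> makes the product rule applicable.\<close>
  then have "(\<lambda>k. ennreal (real (Suc k) powr (1 - p) * max 0 C)) \<longlonglongrightarrow> ennreal (0 * max 0 C)"
    by (intro tendsto_ennrealI tendsto_mult tendsto_const)
  moreover have "ennreal (max 0 C) = ennreal C" by (auto simp: max_def ennreal_neg)
  ultimately have "(\<lambda>k. ennreal (real (Suc k) powr (1 - p)) * ennreal C) \<longlonglongrightarrow> 0"
    by (simp add: ennreal_mult)
  then have "(\<lambda>k. (\<integral>\<^sup>+\<omega>. ennreal (g \<omega>) \<partial>M) + ennreal (real (Suc k) powr (1 - p)) * ennreal C)
      \<longlonglongrightarrow> (\<integral>\<^sup>+\<omega>. ennreal (g \<omega>) \<partial>M) + 0"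
    by (intro tendsto_add tendsto_const)
  then have "ennreal c0 \<le> (\<integral>\<^sup>+\<omega>. ennreal (g \<omega>) \<partial>M) + 0"
  proof (rule LIMSEQ_le_const)
    show "\<exists>N. \<forall>k\<ge>N. ennreal c0 \<le> (\<integral>\<^sup>+\<omega>. ennreal (g \<omega>) \<partial>M) + ennreal (real (Suc k) powr (1 - p)) * ennreal C"
      by (intro exI allI impI main) simp
  qed
  then show ?thesis by simp
qed

text \<open>With this ratio, \<open>Suc m\<close> steps lead from 1 to \<open>n\<close>.\<close>

definition geometric_ratio :: "nat \<Rightarrow> nat \<Rightarrow> real" where
  "geometric_ratio n m = exp (ln (real n) / real (Suc m))"

lemma geometric_ratio_gt_1: "n \<ge> 2 \<Longrightarrow> geometric_ratio n m > 1"
  by (simp add: geometric_ratio_def)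

lemma geometric_ratio_power: "n \<ge> 2 \<Longrightarrow> geometric_ratio n m ^ Suc m = real n"
  by (simp add: geometric_ratio_def exp_of_nat_mult[symmetric] del: power_Suc of_nat_Suc)

lemma geometric_ratio_tendsto: "(\<lambda>m. geometric_ratio n m) \<longlonglongrightarrow> 1"
proof -
  have "(\<lambda>m. exp (L / real (Suc m))) \<longlonglongrightarrow> 1" for L :: real
    by real_asymp
  then show ?thesis unfolding geometric_ratio_def .
qed

text \<open>The source of the power law: the square root halves the exponent
  \<open>-2 * \<alpha> * ln n\<close>, and the reciprocal flips its sign.\<close>

lemma tilt_rate_tendsto:
  assumes "n \<ge> 2"
  shows "(\<lambda>m. 1 / sqrt (tilt_rate \<alpha> (geometric_ratio n m) ^ Suc m)) \<longlonglongrightarrow> real n powr \<alpha>"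
proof -
  have "(\<lambda>m. 1 / sqrt (tilt_rate \<alpha> (geometric_ratio n m) ^ Suc m)) \<longlonglongrightarrow> 1 / sqrt (exp (- 2 * \<alpha> * ln (real n)))"
    unfolding geometric_ratio_def
    by (intro tendsto_divide tendsto_const tendsto_real_sqrt tilt_rate_power_tendsto) simp
  also have "sqrt (exp (- 2 * \<alpha> * ln (real n))) = exp (- \<alpha> * ln (real n))"
    by (rule real_sqrt_unique) (auto simp: power2_eq_square exp_add[symmetric])
  also have "1 / exp (- \<alpha> * ln (real n)) = real n powr \<alpha>"
    using assms by (simp add: powr_def exp_minus field_simps)
  finally show ?thesis .
qed

lemma tilt_weight_tendsto:
  assumes "\<alpha> < 1 / 4"
  shows "(\<lambda>m. tilt_weight \<alpha> (geometric_ratio n m)) \<longlonglongrightarrow> \<alpha> * (1 - 2 * \<alpha>)"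
proof -
  have "(\<lambda>m. tilt_weight \<alpha> (geometric_ratio n m)) \<longlonglongrightarrow> \<alpha> * (1 - 2 * \<alpha>) / (1 + (1 - 1) * (1 - 2 * \<alpha>))"
    unfolding tilt_weight_def
    by (intro tendsto_intros geometric_ratio_tendsto) auto
  then show ?thesis by simp
qed

text \<open>On \<open>{1..n}\<close> the integrand is continuous along each path, hence uniformly
  continuous, and no cell of the grid is longer than \<open>n * (q - 1)\<close>, which tends to
  0.\<close>

lemma geometric_sum_tendsto_Lhat:
  assumes bm: "brownian_motion M B" and \<omega>: "\<omega> \<in> space M" and n: "n \<ge> 2"
  shows "(\<lambda>m. geometric_sum B (geometric_ratio n m) (Suc m) \<omega>) \<longlonglongrightarrow> Lhat B n \<omega>"
proof -
  define f where "f s = (B s \<omega>)\<^sup>2 / s\<^sup>2" for s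
  have cB: "continuous_on {0..} (\<lambda>t. B t \<omega>)" using bm \<omega> by (simp add: brownian_motion_def)
  have f: "continuous_on {1..real n} f"
    unfolding f_def by (intro continuous_intros continuous_on_subset[OF cB]) auto
  have uc: "uniformly_continuous_on {1..real n} f"
    by (rule compact_uniformly_continuous[OF f]) simp
  show ?thesis
  proof (rule LIMSEQ_I)
    fix r :: real assume r: "r > 0"
    define \<epsilon> where "\<epsilon> = r / (2 * real n)"
    have \<epsilon>: "\<epsilon> > 0" using r n by (simp add: \<epsilon>_def)
    obtain d where d: "d > 0" "\<And>x y. x \<in> {1..real n} \<Longrightarrow> y \<in> {1..real n} \<Longrightarrow> dist y x < d \<Longrightarrow> dist (f y) (f x) < \<epsilon>"
      using uc \<epsilon> unfolding uniformly_continuous_on_def by meson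
    have "(\<lambda>m. real n * (geometric_ratio n m - 1)) \<longlonglongrightarrow> real n * (1 - 1)"
      by (intro tendsto_intros geometric_ratio_tendsto)
    then have "\<forall>\<^sub>F m in sequentially. real n * (geometric_ratio n m - 1) < d"
      using d(1) by (intro order_tendstoD(2)[where y = "real n * (1 - 1)"]) auto
    then obtain m0 where m0: "\<And>m. m \<ge> m0 \<Longrightarrow> real n * (geometric_ratio n m - 1) < d"
      by (auto simp: eventually_sequentially)
    have "norm (geometric_sum B (geometric_ratio n m) (Suc m) \<omega> - Lhat B n \<omega>) < r" if "m \<ge> m0" for m
    proof -
      define q where "q = geometric_ratio n m"
      have q: "q > 1" "q ^ Suc m = real n"
        using geometric_ratio_gt_1[OF n] geometric_ratio_power[OF n] by (auto simp: q_def)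
      have qn: "1 \<le> q ^ i \<and> q ^ i \<le> real n" if "i \<le> Suc m" for i
        using q power_increasing[OF that, of q] by auto
      have step: "q ^ Suc i - q ^ i < d" if "i < Suc m" for i
      proof -
        have "q ^ Suc i - q ^ i = q ^ i * (q - 1)" by (simp add: algebra_simps)
        also have "\<dots> \<le> real n * (q - 1)" using qn[of i] that q by (intro mult_right_mono) auto
        also have "\<dots> < d" using m0[OF \<open>m \<ge> m0\<close>] by (simp add: q_def)
        finally show ?thesis .
      qed
      have "\<bar>(\<Sum>i<Suc m. (q ^ Suc i - q ^ i) * f (q ^ i)) - integral {q ^ 0..q ^ Suc m} f\<bar> \<le> \<epsilon> * (q ^ Suc m - q ^ 0)"
      proof (rule left_riemann_sum_error[where b = "real n"])
        show "continuous_on {q ^ 0..real n} f" using f by simp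
        show "mono (\<lambda>i. q ^ i)" using q by (intro monoI power_increasing) auto
        show "q ^ i \<le> real n" if "i \<le> Suc m" for i using qn[OF that] by simp
        fix i x assume i: "i < Suc m" and x: "x \<in> {q ^ i..q ^ Suc i}"
        have "dist (f x) (f (q ^ i)) < \<epsilon>"
          using qn[of i] qn[of "Suc i"] i x step[OF i] by (intro d(2)) (auto simp: dist_real_def)
        then show "\<bar>f x - f (q ^ i)\<bar> \<le> \<epsilon>" by (simp add: dist_real_def)
      qed
      moreover have "(\<Sum>i<Suc m. (q ^ Suc i - q ^ i) * f (q ^ i)) = geometric_sum B q (Suc m) \<omega>"
        unfolding geometric_sum_def sum_distrib_left f_def
        by (intro sum.cong refl) (use q in \<open>simp add: power2_eq_square field_simps\<close>)
      moreover have "integral {q ^ 0..q ^ Suc m} f = Lhat B n \<omega>"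
        unfolding q(2) Lhat_def f_def by simp
      moreover have "\<epsilon> * (q ^ Suc m - q ^ 0) < r"
      proof -
        have "\<epsilon> * (q ^ Suc m - q ^ 0) \<le> \<epsilon> * real n" unfolding q(2) using \<epsilon> by simp
        also have "\<dots> < r" using r n by (simp add: \<epsilon>_def)
        finally show ?thesis .
      qed
      ultimately show ?thesis by (simp add: q_def)
    qed
    then show "\<exists>m0. \<forall>m\<ge>m0. norm (geometric_sum B (geometric_ratio n m) (Suc m) \<omega> - Lhat B n \<omega>) < r"
      by blast
  qed
qed

section \<open>Grid bounds with constants independent of the mesh and the number of steps\<close>

lemma tilted_moment_mono:
  assumes "\<theta> \<le> \<theta>'" "w \<le> w'" "q \<ge> 1"
  shows "tilted_moment M B q w \<theta> m \<le> tilted_moment M B q w' \<theta>' m"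
  unfolding tilted_moment_def
  using assms geometric_sum_nonneg[OF assms(3)]
  by (intro nn_integral_mono ennreal_leI iffD2[OF exp_le_cancel_iff] add_mono mult_right_mono) auto

lemma tilted_moment_upper:
  fixes \<alpha> :: real
  assumes bm: "brownian_motion M B" and \<alpha>: "\<alpha> < 1 / 4"
  obtains C where "C > 0" "\<And>q m. q > 1 \<Longrightarrow>
    tilted_moment M B q (tilt_weight \<alpha> q) (1 / 4) m \<le> ennreal (C * (1 / sqrt (tilt_rate \<alpha> q ^ m)))"
proof -
  \<comment> \<open>The least value meeting both lower conditions; which of the two binds depends on
    the sign of \<open>\<alpha>\<close>. The upper condition holds in either case because
    \<open>1 - 4 * \<alpha> < 2 * (1 - 2 * \<alpha>)\<close>. Only \<open>\<alpha>\<close> enters,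
    so \<open>C\<close> is uniform in \<open>q\<close> and \<open>m\<close>.\<close>
  define V where "V = max (1 / (1 - 4 * \<alpha>)) (1 / (1 - 2 * \<alpha>))"
  have "V \<ge> 1 / (1 - 4 * \<alpha>)" "V \<ge> 1 / (1 - 2 * \<alpha>)" by (auto simp: V_def)
  then have V: "V * (1 - 4 * \<alpha>) \<ge> 1" "V * (1 - 2 * \<alpha>) \<ge> 1" using \<alpha> by (auto simp: pos_divide_le_eq)
  have V3: "V * (1 - 4 * \<alpha>) < 2"
    using \<alpha> by (auto simp: V_def max_def field_simps)
  define C where "C = 1 / sqrt (1 - 2 * \<alpha>) * (1 / sqrt (1 - 2 * (1 / 4 - \<alpha>) * V))"
  have "2 * (1 / 4 - \<alpha>) * V < 1" using V3 by (simp add: algebra_simps)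
  then have "C > 0" using \<alpha> by (simp add: C_def)
  moreover have "tilted_moment M B q (tilt_weight \<alpha> q) (1 / 4) m \<le> ennreal (C * (1 / sqrt (tilt_rate \<alpha> q ^ m)))"
    if "q > 1" for q m
    using tilted_moment_le[OF bm that \<alpha> V V3, of "1 / 4" m] \<alpha> by (simp add: C_def mult_ac)
  ultimately show ?thesis by (rule that)
qed

text \<open>For positive \<open>\<alpha>\<close> the exactly known moment with terminal exponent
  \<open>\<alpha>\<close> exceeds the one without terminal factor. The surplus is controlled by
  splitting at a level \<open>K\<close> of the terminal variable, the part above being absorbed by
  the bound at exponent 1/4.\<close>

lemma tilted_moment_lower:
  fixes \<alpha> :: real
  assumes bm: "brownian_motion M B" and \<alpha>: "\<alpha> < 1 / 4"
  obtains c where "c > 0" "\<And>q m. q > 1 \<Longrightarrow>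
    ennreal (c * (1 / sqrt (tilt_rate \<alpha> q ^ m))) \<le> tilted_moment M B q (tilt_weight \<alpha> q) 0 m"
proof -
  obtain C where C: "C > 0" "\<And>q m. q > 1 \<Longrightarrow>
    tilted_moment M B q (tilt_weight \<alpha> q) (1 / 4) m \<le> ennreal (C * (1 / sqrt (tilt_rate \<alpha> q ^ m)))"
    using tilted_moment_upper[OF assms] by blast
  define c1 where "c1 = 1 / sqrt (1 - 2 * \<alpha>)"
  have c1: "c1 > 0" using \<alpha> by (simp add: c1_def)
  \<comment> \<open>Chosen so that the part above \<open>K\<close> takes at most half of the exact
    value.\<close>
  define K where "K = max 0 (ln (2 * C / c1) / (1 / 4 - \<alpha>))"
  have "ln (2 * C / c1) / (1 / 4 - \<alpha>) \<le> K" by (simp add: K_def)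
  then have "ln (2 * C / c1) \<le> (1 / 4 - \<alpha>) * K" using \<alpha> by (simp add: pos_divide_le_eq mult_ac)
  then have "exp (- ((1 / 4 - \<alpha>) * K)) \<le> exp (- ln (2 * C / c1))" by simp
  also have "\<dots> = c1 / (2 * C)" using C c1 by (simp add: exp_minus)
  finally have K: "exp (- ((1 / 4 - \<alpha>) * K)) * C \<le> c1 / 2" using C(1) by (simp add: field_simps)
  \<comment> \<open>The other half, divided by the factor paid below \<open>K\<close>.\<close>
  define c where "c = c1 / 2 * exp (- (\<bar>\<alpha>\<bar> * K))"
  have "c > 0" using c1 by (simp add: c_def)
  moreover have "ennreal (c * (1 / sqrt (tilt_rate \<alpha> q ^ m))) \<le> tilted_moment M B q (tilt_weight \<alpha> q) 0 m"
    if q: "q > 1" for q m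
  proof -
    define w where "w = tilt_weight \<alpha> q"
    define \<kappa> where "\<kappa> = 1 / sqrt (tilt_rate \<alpha> q ^ m)"
    have \<kappa>: "\<kappa> > 0" using tilt_rate_weight(4)[OF bm q \<alpha>] by (simp add: \<kappa>_def)
    define T where "T \<theta> = tilted_moment M B q w \<theta> m" for \<theta>
    have [measurable]: "B (q ^ m) \<in> borel_measurable M"
      using bm q by (simp add: brownian_motion_measurable)
    have [measurable]: "geometric_sum B q m \<in> borel_measurable M"
      using bm q by (simp add: geometric_sum_measurable)
    have pt: "exp (\<alpha> * y) \<le> exp (\<bar>\<alpha>\<bar> * K) * exp (0 * y) + exp (- ((1 / 4 - \<alpha>) * K)) * exp (1 / 4 * y)" if "y \<ge> 0" for y
    proof (cases "y \<le> K")
      case True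
      have "\<alpha> * y \<le> \<bar>\<alpha>\<bar> * K" using True that by (intro mult_mono) auto
      then have "exp (\<alpha> * y) \<le> exp (\<bar>\<alpha>\<bar> * K)" by simp
      then show ?thesis by (simp add: add_increasing2)
    next
      case False
      have "(1 / 4 - \<alpha>) * K \<le> (1 / 4 - \<alpha>) * y" using False \<alpha> by (intro mult_left_mono) auto
      then have "\<alpha> * y \<le> - ((1 / 4 - \<alpha>) * K) + 1 / 4 * y" by (simp add: algebra_simps)
      then have "exp (\<alpha> * y) \<le> exp (- ((1 / 4 - \<alpha>) * K)) * exp (1 / 4 * y)"
        by (simp only: exp_add[symmetric] exp_le_cancel_iff)
      then show ?thesis by (simp add: add_increasing)
    qed
    have "T \<alpha> \<le> (\<integral>\<^sup>+\<omega>. ennreal (exp (\<bar>\<alpha>\<bar> * K)) * ennreal (exp (0 * ((B (q ^ m) \<omega>)\<^sup>2 / q ^ m) + w * geometric_sum B q m \<omega>))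
       + ennreal (exp (- ((1 / 4 - \<alpha>) * K))) * ennreal (exp (1 / 4 * ((B (q ^ m) \<omega>)\<^sup>2 / q ^ m) + w * geometric_sum B q m \<omega>)) \<partial>M)"
      unfolding T_def tilted_moment_def
    proof (intro nn_integral_mono)
      fix \<omega>
      define y where "y = (B (q ^ m) \<omega>)\<^sup>2 / q ^ m"
      define g where "g = w * geometric_sum B q m \<omega>"
      have "y \<ge> 0" using q by (simp add: y_def)
      from mult_right_mono[OF pt[OF this], of "exp g"]
      have "exp (\<alpha> * y + g) \<le> exp (\<bar>\<alpha>\<bar> * K) * exp (0 * y + g) + exp (- ((1 / 4 - \<alpha>) * K)) * exp (1 / 4 * y + g)"
        by (simp add: exp_add algebra_simps)
      then show "ennreal (exp (\<alpha> * y + g)) \<le> ennreal (exp (\<bar>\<alpha>\<bar> * K)) * ennreal (exp (0 * y + g))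
         + ennreal (exp (- ((1 / 4 - \<alpha>) * K))) * ennreal (exp (1 / 4 * y + g))"
        by (simp add: ennreal_mult[symmetric] ennreal_plus[symmetric] ennreal_leI del: ennreal_plus)
    qed
    also have "\<dots> = ennreal (exp (\<bar>\<alpha>\<bar> * K)) * T 0 + ennreal (exp (- ((1 / 4 - \<alpha>) * K))) * T (1 / 4)"
      unfolding T_def tilted_moment_def
      by (subst nn_integral_add) (simp_all add: nn_integral_cmult)
    finally have main: "T \<alpha> \<le> ennreal (exp (\<bar>\<alpha>\<bar> * K)) * T 0 + ennreal (exp (- ((1 / 4 - \<alpha>) * K))) * T (1 / 4)" .
    have Ta: "T \<alpha> = ennreal (c1 * \<kappa>)"
      unfolding T_def w_def tilted_moment_eigen[OF bm q \<alpha>] c1_def \<kappa>_def by (simp add: mult.commute)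
    have T4: "T (1 / 4) \<le> ennreal (C * \<kappa>)" using C(2)[OF q] by (simp add: T_def w_def \<kappa>_def)
    \<comment> \<open>Finiteness of \<open>T 0\<close> allows the absorption to be carried out by
      subtraction in the reals.\<close>
    have "T 0 \<le> T (1 / 4)" unfolding T_def using q by (intro tilted_moment_mono) auto
    then have "T 0 < top" using T4 by (meson ennreal_less_top order.strict_trans1)
    then obtain x where x: "x \<ge> 0" "T 0 = ennreal x" by (cases "T 0") auto
    have "ennreal (c1 * \<kappa>) \<le> ennreal (exp (\<bar>\<alpha>\<bar> * K)) * ennreal x + ennreal (exp (- ((1 / 4 - \<alpha>) * K))) * ennreal (C * \<kappa>)"
      using main T4 unfolding Ta x(2) by (meson add_left_mono mult_left_mono order_trans zero_le)
    also have "\<dots> = ennreal (exp (\<bar>\<alpha>\<bar> * K) * x + exp (- ((1 / 4 - \<alpha>) * K)) * (C * \<kappa>))"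
      using x C(1) \<kappa> by (simp add: ennreal_mult ennreal_plus)
    finally have "c1 * \<kappa> \<le> exp (\<bar>\<alpha>\<bar> * K) * x + exp (- ((1 / 4 - \<alpha>) * K)) * (C * \<kappa>)"
      using x C(1) \<kappa> by (subst (asm) ennreal_le_iff) (auto intro!: add_nonneg_nonneg)
    also have "exp (- ((1 / 4 - \<alpha>) * K)) * (C * \<kappa>) \<le> c1 / 2 * \<kappa>"
      using mult_right_mono[OF K, of \<kappa>] \<kappa> by (simp add: mult_ac)
    finally have "c1 / 2 * \<kappa> \<le> exp (\<bar>\<alpha>\<bar> * K) * x" by simp
    then have "c * \<kappa> \<le> x" by (simp add: c_def exp_minus field_simps)
    then show ?thesis using x by (simp add: T_def w_def \<kappa>_def ennreal_leI)
  qed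
  ultimately show ?thesis by (rule that)
qed

section \<open>Bounds for the exponential moment of \<open>Lhat\<close>\<close>

text \<open>Each grid sum involves \<open>B\<close> at finitely many fixed times, and pathwise
  limits preserve measurability.\<close>

lemma Lhat_measurable:
  assumes bm: "brownian_motion M B" and n: "n \<ge> 2"
  shows "Lhat B n \<in> borel_measurable M"
proof (rule borel_measurable_LIMSEQ_real[OF geometric_sum_tendsto_Lhat[OF bm _ n]])
  show "geometric_sum B (geometric_ratio n m) (Suc m) \<in> borel_measurable M" for m
    using geometric_ratio_gt_1[OF n, of m] by (intro geometric_sum_measurable[OF bm]) simp
qed

lemma exp_geometric_sum_tendsto:
  assumes "brownian_motion M B" "\<omega> \<in> space M" "n \<ge> 2" "\<alpha> < 1 / 4"
  shows "(\<lambda>m. exp (tilt_weight \<alpha> (geometric_ratio n m) * geometric_sum B (geometric_ratio n m) (Suc m) \<omega>))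
    \<longlonglongrightarrow> exp (\<alpha> * (1 - 2 * \<alpha>) * Lhat B n \<omega>)"
  using assms by (intro tendsto_intros tilt_weight_tendsto geometric_sum_tendsto_Lhat)

text \<open>Fatou along the grids of ratio \<open>geometric_ratio n m\<close>, after raising the
  terminal exponent from 0 to 1/4. The constant is the one on the grid, hence independent of
  \<open>n\<close>.\<close>

lemma exp_Lhat_upper:
  fixes \<alpha> :: real
  assumes bm: "brownian_motion M B" and \<alpha>: "\<alpha> < 1 / 4"
  obtains C where "C > 0" "\<And>n. n \<ge> 2 \<Longrightarrow>
    (\<integral>\<^sup>+\<omega>. ennreal (exp (\<alpha> * (1 - 2 * \<alpha>) * Lhat B n \<omega>)) \<partial>M) \<le> ennreal (C * real n powr \<alpha>)"
proof -
  obtain C where C: "C > 0" "\<And>q m. q > 1 \<Longrightarrow>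
    tilted_moment M B q (tilt_weight \<alpha> q) (1 / 4) m \<le> ennreal (C * (1 / sqrt (tilt_rate \<alpha> q ^ m)))"
    using tilted_moment_upper[OF assms] by blast
  have "(\<integral>\<^sup>+\<omega>. ennreal (exp (\<alpha> * (1 - 2 * \<alpha>) * Lhat B n \<omega>)) \<partial>M) \<le> ennreal (C * real n powr \<alpha>)"
    if n: "n \<ge> 2" for n
  proof -
    let ?q = "geometric_ratio n"
    have q: "?q m > 1" for m using geometric_ratio_gt_1[OF n] .
    have [measurable]: "geometric_sum B (?q m) (Suc m) \<in> borel_measurable M" for m
      using bm q[of m] by (simp add: geometric_sum_measurable)
    let ?f = "\<lambda>m \<omega>. exp (tilt_weight \<alpha> (?q m) * geometric_sum B (?q m) (Suc m) \<omega>)"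
    have "(\<integral>\<^sup>+\<omega>. ennreal (exp (\<alpha> * (1 - 2 * \<alpha>) * Lhat B n \<omega>)) \<partial>M)
        = (\<integral>\<^sup>+\<omega>. liminf (\<lambda>m. ennreal (?f m \<omega>)) \<partial>M)"
      by (intro nn_integral_cong lim_imp_Liminf[symmetric] tendsto_ennrealI
          exp_geometric_sum_tendsto[OF bm _ n \<alpha>]) auto
    also have "\<dots> \<le> liminf (\<lambda>m. \<integral>\<^sup>+\<omega>. ennreal (?f m \<omega>) \<partial>M)"
      by (rule nn_integral_liminf) measurable
    also have "\<dots> \<le> liminf (\<lambda>m. ennreal (C * (1 / sqrt (tilt_rate \<alpha> (?q m) ^ Suc m))))"
    proof (intro Liminf_mono always_eventually allI)
      fix m
      have "(\<integral>\<^sup>+\<omega>. ennreal (?f m \<omega>) \<partial>M) = tilted_moment M B (?q m) (tilt_weight \<alpha> (?q m)) 0 (Suc m)"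
        by (simp add: tilted_moment_def)
      also have "\<dots> \<le> tilted_moment M B (?q m) (tilt_weight \<alpha> (?q m)) (1 / 4) (Suc m)"
        using q[of m] by (intro tilted_moment_mono) auto
      also have "\<dots> \<le> ennreal (C * (1 / sqrt (tilt_rate \<alpha> (?q m) ^ Suc m)))" by (rule C(2)[OF q])
      finally show "(\<integral>\<^sup>+\<omega>. ennreal (?f m \<omega>) \<partial>M) \<le> ennreal (C * (1 / sqrt (tilt_rate \<alpha> (?q m) ^ Suc m)))" .
    qed
    also have "\<dots> = ennreal (C * real n powr \<alpha>)"
      by (intro lim_imp_Liminf tendsto_ennrealI tendsto_mult tendsto_const tilt_rate_tendsto n) auto
    finally show ?thesis .
  qed
  with C(1) show ?thesis by (rule that)
qed

text \<open>Supplies the uniform integrability: taking the power \<open>p\<close> of the integrand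
  multiplies its weight by \<open>p\<close>. The bound may depend on \<open>n\<close>, which is
  fixed while the mesh tends to 0.\<close>

lemma tilted_moment_power_bounded:
  fixes \<alpha> :: real
  assumes bm: "brownian_motion M B" and \<alpha>: "\<alpha> < 1 / 4" and n: "n \<ge> 2"
  obtains p C where "p > 1" "\<And>m.
    tilted_moment M B (geometric_ratio n m) (p * tilt_weight \<alpha> (geometric_ratio n m)) 0 (Suc m) \<le> ennreal C"
proof (cases "\<alpha> \<le> 0")
  case True
  interpret prob_space M using bm by (simp add: brownian_motion_def)
  \<comment> \<open>The weight is nonpositive here, so the integrand is at most 1 and any
    \<open>p > 1\<close> would serve.\<close>
  have "tilted_moment M B (geometric_ratio n m) (2 * tilt_weight \<alpha> (geometric_ratio n m)) 0 (Suc m) \<le> ennreal 1" for m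
  proof -
    have q: "geometric_ratio n m > 1" by (rule geometric_ratio_gt_1[OF n])
    have "tilt_weight \<alpha> (geometric_ratio n m) \<le> 0"
      unfolding tilt_weight_def using True q
      by (intro divide_nonpos_nonneg mult_nonpos_nonneg add_nonneg_nonneg mult_nonneg_nonneg) auto
    then have "tilted_moment M B (geometric_ratio n m) (2 * tilt_weight \<alpha> (geometric_ratio n m)) 0 (Suc m)
        \<le> tilted_moment M B (geometric_ratio n m) 0 0 (Suc m)"
      using q by (intro tilted_moment_mono) auto
    also have "\<dots> = 1" by (simp add: tilted_moment_def emeasure_space_1)
    finally show ?thesis by simp
  qed
  then show ?thesis by (intro that[of 2 1]) auto
next
  case False
  \<comment> \<open>There is room between \<open>\<alpha>\<close> and 1/4, and
    \<open>x * (1 - 2 * x)\<close> increases up to 1/4; the ratio of its values at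
    \<open>\<beta>\<close> and \<open>\<alpha>\<close> is thus an exponent
    \<open>p > 1\<close>.\<close>
  define \<beta> where "\<beta> = (\<alpha> + 1 / 4) / 2"
  have \<beta>: "\<beta> < 1 / 4" "\<alpha> < \<beta>" using \<alpha> by (auto simp: \<beta>_def)
  define p where "p = \<beta> * (1 - 2 * \<beta>) / (\<alpha> * (1 - 2 * \<alpha>))"
  have ap: "\<alpha> * (1 - 2 * \<alpha>) > 0" using False \<alpha> by simp
  have "\<beta> * (1 - 2 * \<beta>) - \<alpha> * (1 - 2 * \<alpha>) = (\<beta> - \<alpha>) * (1 - 2 * (\<alpha> + \<beta>))" by (simp add: algebra_simps)
  also have "\<dots> > 0" using \<alpha> \<beta> by (intro mult_pos_pos) auto
  finally have p: "p > 1" using ap by (simp add: p_def)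
  have pw: "p * tilt_weight \<alpha> q \<le> tilt_weight \<beta> q" if q: "q > 1" for q
  proof -
    have "p * tilt_weight \<alpha> q = \<beta> * (1 - 2 * \<beta>) / (1 + (q - 1) * (1 - 2 * \<alpha>))"
      unfolding tilt_weight_def p_def using False \<alpha> by simp
    \<comment> \<open>The numerators agree by the choice of \<open>p\<close>, and the denominator
      decreases as \<open>\<alpha>\<close> is replaced by \<open>\<beta>\<close>.\<close>
    also have "\<dots> \<le> tilt_weight \<beta> q"
      unfolding tilt_weight_def using False \<alpha> \<beta> q
      by (intro divide_left_mono add_left_mono mult_left_mono mult_pos_pos add_pos_nonneg mult_nonneg_nonneg) auto
    finally show ?thesis .
  qed
  obtain C where C: "C > 0" "\<And>q m. q > 1 \<Longrightarrow>
    tilted_moment M B q (tilt_weight \<beta> q) (1 / 4) m \<le> ennreal (C * (1 / sqrt (tilt_rate \<beta> q ^ m)))"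
    using tilted_moment_upper[OF bm \<beta>(1)] by blast
  have "Bseq (\<lambda>m. 1 / sqrt (tilt_rate \<beta> (geometric_ratio n m) ^ Suc m))"
    using tilt_rate_tendsto[OF n, of \<beta>] by (intro convergent_imp_Bseq) (auto simp: convergent_def)
  then obtain b where b: "\<And>m. norm (1 / sqrt (tilt_rate \<beta> (geometric_ratio n m) ^ Suc m)) \<le> b"
    by (auto simp: Bseq_def)
  have "tilted_moment M B (geometric_ratio n m) (p * tilt_weight \<alpha> (geometric_ratio n m)) 0 (Suc m) \<le> ennreal (C * b)" for m
  proof -
    have q: "geometric_ratio n m > 1" by (rule geometric_ratio_gt_1[OF n])
    have "tilted_moment M B (geometric_ratio n m) (p * tilt_weight \<alpha> (geometric_ratio n m)) 0 (Suc m)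
       \<le> tilted_moment M B (geometric_ratio n m) (tilt_weight \<beta> (geometric_ratio n m)) (1 / 4) (Suc m)"
      using q pw[OF q] by (intro tilted_moment_mono) auto
    also have "\<dots> \<le> ennreal (C * (1 / sqrt (tilt_rate \<beta> (geometric_ratio n m) ^ Suc m)))"
      by (rule C(2)[OF q])
    also have "\<dots> \<le> ennreal (C * b)"
      using C(1) order_trans[OF abs_ge_self b[of m, unfolded real_norm_def]]
      by (intro ennreal_leI mult_left_mono) linarith+
    finally show ?thesis .
  qed
  with p show ?thesis by (rule that)
qed

text \<open>The grid bound without terminal factor survives the limit by uniform integrability; its
  constant does not depend on \<open>n\<close>.\<close>

lemma exp_Lhat_lower:
  fixes \<alpha> :: real
  assumes bm: "brownian_motion M B" and \<alpha>: "\<alpha> < 1 / 4"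
  obtains c where "c > 0" "\<And>n. n \<ge> 2 \<Longrightarrow>
    ennreal (c * real n powr \<alpha>) \<le> (\<integral>\<^sup>+\<omega>. ennreal (exp (\<alpha> * (1 - 2 * \<alpha>) * Lhat B n \<omega>)) \<partial>M)"
proof -
  obtain c where c: "c > 0" "\<And>q m. q > 1 \<Longrightarrow>
    ennreal (c * (1 / sqrt (tilt_rate \<alpha> q ^ m))) \<le> tilted_moment M B q (tilt_weight \<alpha> q) 0 m"
    using tilted_moment_lower[OF assms] by blast
  have "ennreal (c * real n powr \<alpha>) \<le> (\<integral>\<^sup>+\<omega>. ennreal (exp (\<alpha> * (1 - 2 * \<alpha>) * Lhat B n \<omega>)) \<partial>M)"
    if n: "n \<ge> 2" for n
  proof -
    let ?q = "geometric_ratio n"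
    have q: "?q m > 1" for m using geometric_ratio_gt_1[OF n] .
    have [measurable]: "geometric_sum B (?q m) (Suc m) \<in> borel_measurable M" for m
      using bm q[of m] by (simp add: geometric_sum_measurable)
    have [measurable]: "Lhat B n \<in> borel_measurable M" by (rule Lhat_measurable[OF bm n])
    let ?f = "\<lambda>m \<omega>. exp (tilt_weight \<alpha> (?q m) * geometric_sum B (?q m) (Suc m) \<omega>)"
    obtain p C where pC: "p > 1" "\<And>m. tilted_moment M B (?q m) (p * tilt_weight \<alpha> (?q m)) 0 (Suc m) \<le> ennreal C"
      using tilted_moment_power_bounded[OF bm \<alpha> n] by blast
    show ?thesis
    proof (rule uniformly_integrable_lower_limit[where f = ?f and p = p and C = C
          and c = "\<lambda>m. c * (1 / sqrt (tilt_rate \<alpha> (?q m) ^ Suc m))"])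
      show "prob_space M" using bm by (simp add: brownian_motion_def)
      show "(\<lambda>m. ?f m \<omega>) \<longlonglongrightarrow> exp (\<alpha> * (1 - 2 * \<alpha>) * Lhat B n \<omega>)" if "\<omega> \<in> space M" for \<omega>
        by (rule exp_geometric_sum_tendsto[OF bm that n \<alpha>])
      show "(\<integral>\<^sup>+\<omega>. ennreal (?f m \<omega> powr p) \<partial>M) \<le> ennreal C" for m
        using pC(2)[of m] by (simp add: tilted_moment_def powr_def mult_ac)
      show "ennreal (c * (1 / sqrt (tilt_rate \<alpha> (?q m) ^ Suc m))) \<le> (\<integral>\<^sup>+\<omega>. ennreal (?f m \<omega>) \<partial>M)" for m
        using c(2)[OF q, of m "Suc m"] by (simp add: tilted_moment_def)
      show "(\<lambda>m. c * (1 / sqrt (tilt_rate \<alpha> (?q m) ^ Suc m))) \<longlonglongrightarrow> c * real n powr \<alpha>"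
        by (intro tendsto_mult tendsto_const tilt_rate_tendsto n)
    qed (use pC(1) in auto)
  qed
  with c(1) show ?thesis by (rule that)
qed

theorem mainTheorem16:
  fixes M :: "'a measure" and B :: "real \<Rightarrow> 'a \<Rightarrow> real" and t :: real
  assumes "brownian_motion M B"
    and "t > -1/8"
  shows "\<exists>C. \<forall>n::nat. n \<ge> 2 \<longrightarrow>
           integrable M (\<lambda>\<omega>. exp (- t * Lhat B n \<omega>)) \<and>
           \<bar>ln (LINT \<omega>|M. exp (- t * Lhat B n \<omega>))
              - (1 - sqrt (1 + 8 * t)) / 4 * ln (real n)\<bar> \<le> C"
proof -
  define \<alpha> where "\<alpha> = (1 - sqrt (1 + 8 * t)) / 4"
  have \<alpha>: "\<alpha> < 1 / 4" using assms(2) by (simp add: \<alpha>_def)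
  \<comment> \<open>The limiting weight of the grid sums is therefore the coefficient
    \<open>- t\<close> of the theorem.\<close>
  have t: "\<alpha> * (1 - 2 * \<alpha>) = - t"
    using assms(2) by (simp add: \<alpha>_def field_simps)
  obtain c where c: "c > 0" "\<And>n. n \<ge> 2 \<Longrightarrow>
      ennreal (c * real n powr \<alpha>) \<le> (\<integral>\<^sup>+\<omega>. ennreal (exp (- t * Lhat B n \<omega>)) \<partial>M)"
    using exp_Lhat_lower[OF assms(1) \<alpha>] unfolding t by blast
  obtain C where C: "C > 0" "\<And>n. n \<ge> 2 \<Longrightarrow>
      (\<integral>\<^sup>+\<omega>. ennreal (exp (- t * Lhat B n \<omega>)) \<partial>M) \<le> ennreal (C * real n powr \<alpha>)"
    using exp_Lhat_upper[OF assms(1) \<alpha>] unfolding t by blast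
  show ?thesis
  \<comment> \<open>The difference in question lies between \<open>ln c\<close> and
    \<open>ln C\<close>, whose signs are unknown.\<close>
  proof (intro exI[of _ "\<bar>ln c\<bar> + \<bar>ln C\<bar>"] allI impI conjI)
    fix n :: nat assume n: "n \<ge> 2"
    have [measurable]: "Lhat B n \<in> borel_measurable M" by (rule Lhat_measurable[OF assms(1) n])
    show int: "integrable M (\<lambda>\<omega>. exp (- t * Lhat B n \<omega>))"
      using C(2)[OF n] by (intro integrableI_nonneg) (auto intro: order.strict_trans1)
    define E where "E = (LINT \<omega>|M. exp (- t * Lhat B n \<omega>))"
    have E: "(\<integral>\<^sup>+\<omega>. ennreal (exp (- t * Lhat B n \<omega>)) \<partial>M) = ennreal E"
      unfolding E_def by (rule nn_integral_eq_integral[OF int]) simp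
    have "E \<ge> 0" unfolding E_def by simp
    then have lo: "c * real n powr \<alpha> \<le> E" and up: "E \<le> C * real n powr \<alpha>"
      using c(2)[OF n] C(2)[OF n] C(1) unfolding E by auto
    have n0: "real n powr \<alpha> > 0" using n by simp
    have "E > 0" using lo c(1) n0 by (meson mult_pos_pos order.strict_trans2)
    have "ln (c * real n powr \<alpha>) \<le> ln E" "ln E \<le> ln (C * real n powr \<alpha>)"
      using lo up c(1) C(1) n0 \<open>E > 0\<close> by simp_all
    moreover have "ln (c * real n powr \<alpha>) = ln c + \<alpha> * ln (real n)" "ln (C * real n powr \<alpha>) = ln C + \<alpha> * ln (real n)"
      using c(1) C(1) n0 n by (simp_all add: ln_mult ln_powr)
    ultimately show "\<bar>ln (LINT \<omega>|M. exp (- t * Lhat B n \<omega>)) - (1 - sqrt (1 + 8 * t)) / 4 * ln (real n)\<bar> \<le> \<bar>ln c\<bar> + \<bar>ln C\<bar>"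
      unfolding E_def[symmetric] \<alpha>_def[symmetric] by linarith
  qed
qed

end
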